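(* Let $(X,\|\cdot\|)$ be a Banach space, $J:X\to X$ a nonexpansive mapping, $\Phi(\lambda,x)=\lambda J\left(\frac{1-\lambda}{\lambda}x\right)$ for $\lambda\in(0,1]$, $x\in X$, let $v_n=\frac{J^n(0)}{n}$ for $n\ge1$, and let $u_0\in X$. There exists a continuous function $\boldsymbol{\lambda}:[0,+\infty)\to(0,1]$ such that $\boldsymbol\lambda(t)\sim\frac1t$ as $t\to+\infty$ and for which the solution $w:[0,+\infty)\to X$ of $$w(t)+w'(t)=\Phi(\boldsymbol\lambda(t),w(t)),\qquad w(0)=u_0,$$ satisfies $$\|w(n)-v_n\|\underset{n\to+\infty}{\longrightarrow}0.$$
   Context: $J$ nonexpansive means $\|J(x)-J(y)\|\le\|x-y\|$ for all $x,y\in X$. $J^n$ is the $n$-fold composition of $J$. For continuous $\boldsymbol\lambda$ the Cauchy problem has a unique $\mathcal C^1$ solution on $[0,+\infty)$. $\boldsymbol\lambda(t)\sim\frac1t$ means $t\boldsymbol\lambda(t)\to1$. *)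

theory Defs
  imports "HOL-Analysis.Analysis"
begin

(* Only the values for 0 < l <= 1 are meaningful. *)
definition Phi :: "('a::real_normed_vector \<Rightarrow> 'a) \<Rightarrow> real \<Rightarrow> 'a \<Rightarrow> 'a" where
  "Phi J l x = l *\<^sub>R J (((1 - l) / l) *\<^sub>R x)"

(* Only the values for n >= 1 are meaningful. *)
definition v_seq :: "('a::real_normed_vector \<Rightarrow> 'a) \<Rightarrow> nat \<Rightarrow> 'a" where
  "v_seq J n = (1 / real n) *\<^sub>R (J ^^ n) 0"

(* Functions on the half-line [0,+oo) are total functions on the reals of which only the
   values at t >= 0 matter; "at t within {0..}" makes the derivative at 0 one-sided. *)
definition is_C1_solution ::
  "('a::real_normed_vector \<Rightarrow> 'a) \<Rightarrow> (real \<Rightarrow> real) \<Rightarrow> 'a \<Rightarrow> (real \<Rightarrow> 'a) \<Rightarrow> bool" where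
  "is_C1_solution J lam u0 w \<longleftrightarrow>
     w 0 = u0 \<and>
     (\<exists>w'. continuous_on {0..} w' \<and>
        (\<forall>t\<ge>0. (w has_vector_derivative w' t) (at t within {0..}) \<and>
                w t + w' t = Phi J (lam t) (w t)))"

(* Uniqueness is agreement on [0,+oo); the values of w at t < 0 are arbitrary. *)
definition is_the_C1_solution ::
  "('a::real_normed_vector \<Rightarrow> 'a) \<Rightarrow> (real \<Rightarrow> real) \<Rightarrow> 'a \<Rightarrow> (real \<Rightarrow> 'a) \<Rightarrow> bool" where
  "is_the_C1_solution J lam u0 w \<longleftrightarrow>
     is_C1_solution J lam u0 w \<and>
     (\<forall>z. is_C1_solution J lam u0 z \<longrightarrow> (\<forall>t\<ge>0. z t = w t))"

end

theory Submission
  imports Defs "HOL-Real_Asymp.Real_Asymp"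
begin

text \<open>
  The equation becomes autonomous after a change of variables. Let \<open>V\<close> solve
  \<open>V' = J V - V\<close>, \<open>V 0 = u0\<close>, and let \<open>\<tau> t\<close> be the root of
  \<open>exp \<tau> + \<tau> = t + 1\<close>, so that \<open>\<tau> 0 = 0\<close> and \<open>\<tau>' = 1 / (1 + exp \<tau>)\<close>. Put
  \<open>\<lambda> = 1 / (1 + exp \<tau>)\<close> and \<open>w t = exp (- \<tau> t) V (exp (\<tau> t) - 1)\<close>. Then
  \<open>(1 - \<lambda>) / \<lambda> = exp \<tau>\<close>, whence \<open>\<Phi> (\<lambda>, w) = \<lambda> J (V (exp \<tau> - 1))\<close>, and the product
  and chain rules show that \<open>w\<close> is the required solution
  (\<open>C1_solution_of_flow\<close>). Since \<open>0 \<le> \<tau> t \<le> ln (1 + t)\<close> for \<open>t \<ge> 0\<close>,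
  \<open>exp (\<tau> t) = 1 + t - \<tau> t\<close> is \<open>t\<close> up to a logarithm, and \<open>t \<lambda> t \<rightarrow> 1\<close>.

  The trajectory \<open>V\<close> is compared with the iterates of \<open>J\<close> by the estimate
  \<open>\<parallel>V t - J\<^sup>n u0\<parallel> \<le> \<parallel>J u0 - u0\<parallel> (((n - t)\<^sup>2 + t) / (2 A) + A / 2)\<close>, valid for all
  \<open>A > 0\<close> and \<open>t \<ge> 0\<close> (\<open>chernoff_estimate\<close>). With \<open>A = sqrt n\<close> and
  \<open>t = exp (\<tau> n) - 1\<close>, which differs from \<open>n\<close> by at most \<open>ln (1 + n)\<close>, the bound is
  of order \<open>sqrt n\<close>; dividing by \<open>exp (\<tau> n)\<close>, which is asymptotic to \<open>n\<close>,
  gives \<open>\<parallel>w n - J\<^sup>n 0 / n\<parallel> \<rightarrow> 0\<close>.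
\<close>

section \<open>Global solutions of Lipschitz autonomous equations\<close>

lemma at_within_atLeast_eq_Icc:
  fixes x a b :: real
  assumes "x < b"
  shows "at x within {a..} = at x within {a..b}"
  by (rule at_within_nhd[of x "{..<b}"]) (use assms in auto)

lemma has_vector_derivative_integral_atLeast:
  fixes g :: "real \<Rightarrow> 'a::banach"
  assumes "continuous_on {0..} g" and "0 \<le> t"
  shows "((\<lambda>s. integral {0..s} g) has_vector_derivative g t) (at t within {0..})"
proof -
  have "((\<lambda>s. integral {0..s} g) has_vector_derivative g t) (at t within {0..t+1})"
    using assms by (intro integral_has_vector_derivative continuous_on_subset[OF assms(1)]) auto
  then show ?thesis
    using at_within_atLeast_eq_Icc[of t "t+1" 0] by simp
qed

lemma norm_weighted_integral_le:
  fixes g :: "real \<Rightarrow> 'a::banach"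
  assumes "K > 0" and "B \<ge> 0" and g: "continuous_on {0..} g"
    and bound: "\<And>r. r \<ge> 0 \<Longrightarrow> norm (g r) \<le> B * exp (K * r)" and "s \<ge> 0"
  shows "norm (exp (- (K * s)) *\<^sub>R integral {0..s} g) \<le> B / K"
proof -
  have e: "((\<lambda>r. B * exp (K * r)) has_integral (B / K * exp (K * s) - B / K * exp (K * 0))) {0..s}"
    using \<open>K > 0\<close> \<open>s \<ge> 0\<close>
    by (intro fundamental_theorem_of_calculus)
      (auto intro!: derivative_eq_intros simp flip: has_real_derivative_iff_has_vector_derivative)
  have "norm (integral {0..s} g) \<le> integral {0..s} (\<lambda>r. B * exp (K * r))"
    using e bound
    by (intro integral_norm_bound_integral integrable_continuous_interval
        continuous_on_subset[OF g] has_integral_integrable[OF e]) auto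
  also have "\<dots> \<le> B / K * exp (K * s)"
    using integral_unique[OF e] assms by simp
  finally show ?thesis
    by (simp add: exp_minus field_simps)
qed

text \<open>
  By \<open>norm_weighted_integral_le\<close>, integrating a function bounded by \<open>B * exp (K * r)\<close> gains
  a factor \<open>1 / K\<close>. With \<open>K = 2 L\<close> the
  Picard operator is therefore a contraction of the functions on the half-line of growth
  \<open>O(exp (K t))\<close>. Such a function is represented by its bounded quotient \<open>z\<close> by
  \<open>exp (K t)\<close>, extended to negative times by its value at \<open>0\<close>; hence the \<open>max t 0\<close>
  in the proof.
\<close>
lemma lipschitz_ode_solution_exists:
  fixes F :: "'a::banach \<Rightarrow> 'a"
  assumes "L > 0" and lip: "\<And>x y. norm (F x - F y) \<le> L * norm (x - y)"
  obtains V where "V 0 = x0"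
    and "\<And>t. t \<ge> 0 \<Longrightarrow> (V has_vector_derivative F (V t)) (at t within {0..})"
proof -
  have contF: "continuous_on UNIV F"
    by (rule lipschitz_on_continuous_on[OF lipschitz_onI[of _ F L]])
      (use assms in \<open>auto simp: dist_norm\<close>)
  define K where "K = 2 * L"
  have "K > 0"
    using \<open>L > 0\<close> by (simp add: K_def)
  define G where "G z r = F (exp (K * r) *\<^sub>R apply_bcontfun z r)" for z r
  have contG: "continuous_on S (G z)" for S z
    unfolding G_def
    by (rule continuous_on_compose2[OF contF]) (auto intro!: continuous_intros)
  define P where "P z s = exp (- (K * s)) *\<^sub>R (x0 + integral {0..s} (G z))" for z s
  have "continuous_on {0..} (\<lambda>s. integral {0..s} (G z))" for z
    using has_vector_derivative_integral_atLeast[OF contG]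
    by (intro continuous_on_vector_derivative) auto
  then have contP: "continuous_on {0..} (P z)" for z
    unfolding P_def by (intro continuous_intros) auto
  have P_le: "norm (P z s) \<le> norm x0 + (norm (F 0) + L * norm z) / K" if "s \<ge> 0" for z s
  proof -
    have "norm (G z r) \<le> (norm (F 0) + L * norm z) * exp (K * r)" if "r \<ge> 0" for r
    proof -
      have "norm (G z r) \<le> norm (F 0) + L * (exp (K * r) * norm (apply_bcontfun z r))"
        using norm_triangle_sub[of "G z r" "F 0"] lip[of "exp (K * r) *\<^sub>R apply_bcontfun z r" 0]
        by (simp add: G_def)
      also have "\<dots> \<le> norm (F 0) * exp (K * r) + L * (exp (K * r) * norm z)"
        using that \<open>L > 0\<close> \<open>K > 0\<close>
        by (intro add_mono mult_left_mono norm_bounded) (auto intro!: mult_right_le_one_le simp: mult_le_cancel_left1)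
      finally show ?thesis
        by (simp add: algebra_simps)
    qed
    then have "norm (exp (- (K * s)) *\<^sub>R integral {0..s} (G z)) \<le> (norm (F 0) + L * norm z) / K"
      using that \<open>L > 0\<close> \<open>K > 0\<close> contG by (intro norm_weighted_integral_le) auto
    moreover have "norm (exp (- (K * s)) *\<^sub>R x0) \<le> norm x0"
      using that \<open>K > 0\<close> by (simp add: mult_left_le_one_le)
    ultimately show ?thesis
      unfolding P_def scaleR_add_right by (rule norm_triangle_le[OF add_mono, rotated])
  qed
  have T_mem: "(\<lambda>t. P z (max t 0)) \<in> bcontfun" for z
    by (rule bcontfun_normI[OF continuous_on_compose2[OF contP] P_le]) (auto intro!: continuous_intros)
  define T where "T z = Bcontfun (\<lambda>t. P z (max t 0))" for z
  have T: "apply_bcontfun (T z) t = P z (max t 0)" for z t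
    unfolding T_def by (simp add: Bcontfun_inverse T_mem)
  have "dist (T y) (T z) \<le> 1/2 * dist y z" for y z
  proof (rule dist_bound)
    fix t :: real
    define s where "s = max t 0"
    have "s \<ge> 0" by (simp add: s_def)
    have "norm (exp (- (K * s)) *\<^sub>R integral {0..s} (\<lambda>r. G y r - G z r)) \<le> (L * dist y z) / K"
    proof (rule norm_weighted_integral_le)
      fix r :: real assume "r \<ge> 0"
      have "norm (G y r - G z r) \<le> L * (exp (K * r) * dist (apply_bcontfun y r) (apply_bcontfun z r))"
        using lip[of "exp (K * r) *\<^sub>R apply_bcontfun y r" "exp (K * r) *\<^sub>R apply_bcontfun z r"]
        by (simp add: G_def dist_norm flip: scaleR_diff_right)
      also have "\<dots> \<le> L * (exp (K * r) * dist y z)"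
        using \<open>L > 0\<close> by (intro mult_left_mono dist_bounded) auto
      finally show "norm (G y r - G z r) \<le> L * dist y z * exp (K * r)"
        by (simp add: algebra_simps)
    qed (use \<open>L > 0\<close> \<open>K > 0\<close> \<open>s \<ge> 0\<close> contG in \<open>auto intro!: continuous_intros\<close>)
    moreover have "P y s - P z s = exp (- (K * s)) *\<^sub>R integral {0..s} (\<lambda>r. G y r - G z r)"
      using contG integral_diff[of "G y" "{0..s}" "G z"]
      by (simp add: P_def integrable_continuous_interval flip: scaleR_diff_right)
    ultimately show "dist (apply_bcontfun (T y) t) (apply_bcontfun (T z) t) \<le> 1/2 * dist y z"
      using \<open>L > 0\<close> by (simp add: T dist_norm s_def K_def)
  qed
  then obtain z where z: "T z = z"
    using banach_fix_type[of "1/2" T] by auto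
  define V where "V t = x0 + integral {0..t} (G z)" for t
  have GV: "G z t = F (V t)" if "t \<ge> 0" for t
  proof -
    have "apply_bcontfun z t = P z t"
      using T[of z t] z that by simp
    then show ?thesis
      by (simp add: G_def V_def P_def flip: exp_add)
  qed
  show thesis
  proof
    show "V 0 = x0" by (simp add: V_def)
    show "(V has_vector_derivative F (V t)) (at t within {0..})" if "t \<ge> 0" for t
      using has_vector_derivative_integral_atLeast[OF contG that] GV[OF that]
      unfolding V_def by (auto intro!: derivative_eq_intros)
  qed
qed

section \<open>Comparison estimates\<close>

text \<open>
  A supersolution bounds the norm: multiplied by \<open>exp t\<close>, both \<open>d + d'\<close> and
  \<open>\<psi> + \<psi>'\<close> become derivatives, and the mean value inequality applies.
\<close>
lemma exp_weighted_comparison: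
  fixes d :: "real \<Rightarrow> 'a::real_normed_vector"
  assumes d: "\<And>t. t \<ge> 0 \<Longrightarrow> (d has_vector_derivative d' t) (at t within {0..})"
    and psi: "\<And>t. (\<psi> has_real_derivative \<psi>' t) (at t)"
    and bound: "\<And>t. 0 < t \<Longrightarrow> t < T \<Longrightarrow> norm (d t + d' t) \<le> \<psi> t + \<psi>' t"
    and "T \<ge> 0"
  shows "exp T * (norm (d T) - \<psi> T) \<le> norm (d 0) - \<psi> 0"
proof (cases "T = 0")
  case False
  then have "T > 0" using \<open>T \<ge> 0\<close> by simp
  have contd: "continuous_on {0..} d"
    using d by (intro continuous_on_vector_derivative) auto
  have contpsi: "continuous_on {0..T} \<psi>"
    by (rule DERIV_continuous_on[OF has_field_derivative_at_within[OF psi]])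
  have "norm (exp T *\<^sub>R d T - exp 0 *\<^sub>R d 0) \<le> exp T * \<psi> T - exp 0 * \<psi> 0"
  proof (rule differentiable_bound_general[OF \<open>T > 0\<close>])
    show "continuous_on {0..T} (\<lambda>t. exp t *\<^sub>R d t)" "continuous_on {0..T} (\<lambda>t. exp t * \<psi> t)"
      using contd contpsi by (auto intro!: continuous_intros intro: continuous_on_subset)
    fix t assume t: "0 < t" "t < T"
    have "at t within {0..} = at t"
      using t by (intro at_within_interior) (simp add: interior_real_atLeast)
    then have "(d has_vector_derivative d' t) (at t)"
      using d[of t] t by simp
    then show "((\<lambda>t. exp t *\<^sub>R d t) has_vector_derivative exp t *\<^sub>R (d t + d' t)) (at t)"
      by (auto intro!: derivative_eq_intros DERIV_exp simp: algebra_simps)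
    show "((\<lambda>t. exp t * \<psi> t) has_vector_derivative exp t * (\<psi> t + \<psi>' t)) (at t)"
      using psi[of t] unfolding has_real_derivative_iff_has_vector_derivative[symmetric]
      by (auto intro!: derivative_eq_intros simp: algebra_simps)
    show "norm (exp t *\<^sub>R (d t + d' t)) \<le> exp t * (\<psi> t + \<psi>' t)"
      using bound[OF t] by simp
  qed
  moreover have "norm (exp T *\<^sub>R d T) - norm (d 0) \<le> norm (exp T *\<^sub>R d T - d 0)"
    by (rule norm_triangle_ineq2)
  ultimately show ?thesis
    by (simp add: algebra_simps)
qed simp

text \<open>
  The hypothesis on \<open>d + d'\<close> holds for the difference \<open>d\<close> of two curves whose values of
  \<open>x + x'\<close> are images of \<open>x\<close> under a common nonexpansive map, up to an error \<open>C\<close>. It yields uniqueness (\<open>C = 0\<close>, \<open>d 0 = 0\<close>) and the linear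
  growth of \<open>V t - V 0\<close>.
\<close>
lemma dissipative_growth_bound:
  fixes d :: "real \<Rightarrow> 'a::real_normed_vector"
  assumes d: "\<And>t. t \<ge> 0 \<Longrightarrow> (d has_vector_derivative d' t) (at t within {0..})"
    and bound: "\<And>t. t \<ge> 0 \<Longrightarrow> norm (d t + d' t) \<le> norm (d t) + C"
    and "T \<ge> 0"
  shows "norm (d T) \<le> norm (d 0) + C * T"
proof -
  define h where "h t = norm (d t) - norm (d 0) - C * t" for t
  have "continuous_on {0..} d"
    using d by (intro continuous_on_vector_derivative) auto
  then have "continuous_on {0..T} h"
    unfolding h_def by (auto intro!: continuous_intros intro: continuous_on_subset)
  then obtain \<tau> where \<tau>: "\<tau> \<in> {0..T}" and max: "\<And>t. t \<in> {0..T} \<Longrightarrow> h t \<le> h \<tau>"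
    using continuous_attains_sup[of "{0..T}" h] \<open>T \<ge> 0\<close> by auto
  \<comment> \<open>The factor \<open>exp \<tau>\<close> multiplies \<open>0\<close>, so what remains is \<open>0 \<le> - h \<tau>\<close>.\<close>
  have "exp \<tau> * (norm (d \<tau>) - (norm (d 0) + C * \<tau> + h \<tau>)) \<le> norm (d 0) - (norm (d 0) + C * 0 + h \<tau>)"
  proof (rule exp_weighted_comparison[OF d])
    show "((\<lambda>t. norm (d 0) + C * t + h \<tau>) has_real_derivative C) (at t)" for t
      by (auto intro!: derivative_eq_intros)
    show "norm (d t + d' t) \<le> norm (d 0) + C * t + h \<tau> + C" if "0 < t" "t < \<tau>" for t
      using bound[of t] max[of t] that \<tau> unfolding h_def[of t] by auto
  qed (use \<tau> in auto)
  then have "h \<tau> \<le> 0"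
    by (simp add: h_def)
  then show ?thesis
    using max[of T] \<open>T \<ge> 0\<close> unfolding h_def[of T] by auto
qed

lemma funpow_nonexpansive:
  fixes J :: "'a::real_normed_vector \<Rightarrow> 'a"
  assumes J: "\<And>x y. norm (J x - J y) \<le> norm (x - y)"
  shows "norm ((J ^^ n) x - (J ^^ n) y) \<le> norm (x - y)"
proof (induction n)
  case (Suc n)
  then show ?case using J[of "(J ^^ n) x" "(J ^^ n) y"] by simp
qed simp

lemma norm_funpow_diff_le:
  fixes J :: "'a::real_normed_vector \<Rightarrow> 'a"
  assumes J: "\<And>x y. norm (J x - J y) \<le> norm (x - y)"
  shows "norm ((J ^^ n) x - x) \<le> real n * norm (J x - x)"
proof (induction n)
  case (Suc n)
  have "norm ((J ^^ Suc n) x - x) \<le> norm (J ((J ^^ n) x) - J x) + norm (J x - x)"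
    using norm_triangle_ineq[of "J ((J ^^ n) x) - J x" "J x - x"] by simp
  then show ?case
    using J[of "(J ^^ n) x" x] Suc by (simp add: algebra_simps)
qed simp

text \<open>
  For every \<open>A\<close> the functions \<open>\<psi>\<^sub>n t = ((n - t)\<^sup>2 + t) / (2 A) + A / 2\<close> satisfy
  \<open>\<psi>\<^sub>n + \<psi>\<^sub>n' = \<psi>\<^sub>n\<^sub>-\<^sub>1\<close> exactly, which matches the inequality
  \<open>\<parallel>d\<^sub>n + d\<^sub>n'\<parallel> \<le> \<parallel>d\<^sub>n\<^sub>-\<^sub>1\<parallel>\<close> for \<open>d\<^sub>n t = V t - J\<^sup>n (V 0)\<close>. The inequality of the
  arithmetic and geometric means gives \<open>\<psi>\<^sub>n 0 \<ge> n\<close> and \<open>\<psi>\<^sub>0 t \<ge> t\<close>, as the initial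
  conditions require. Optimizing over \<open>A\<close> turns the bound into
  \<open>sqrt ((n - t)\<^sup>2 + t)\<close>.
\<close>
lemma chernoff_estimate:
  fixes J :: "'a::real_normed_vector \<Rightarrow> 'a"
  assumes J: "\<And>x y. norm (J x - J y) \<le> norm (x - y)"
    and V: "\<And>t. t \<ge> 0 \<Longrightarrow> (V has_vector_derivative J (V t) - V t) (at t within {0..})"
    and "A > 0" and "t \<ge> 0"
  shows "norm (V t - (J ^^ n) (V 0))
    \<le> norm (J (V 0) - V 0) * (((real n - t)\<^sup>2 + t) / (2 * A) + A / 2)"
  using \<open>t \<ge> 0\<close>
proof (induction n arbitrary: t)
  define C where "C = norm (J (V 0) - V 0)"
  have "C \<ge> 0" by (simp add: C_def)
  have am_gm: "x \<le> x\<^sup>2 / (2 * A) + A / 2" for x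
    using \<open>A > 0\<close> sum_squares_bound[of x A] by (simp add: field_simps power2_eq_square)
  {
    case 0
    have "norm (V t - V 0) \<le> norm (V 0 - V 0) + C * t"
    proof (rule dissipative_growth_bound[where d = "\<lambda>t. V t - V 0"])
      show "((\<lambda>t. V t - V 0) has_vector_derivative J (V t) - V t) (at t within {0..})" if "t \<ge> 0" for t
        using V[OF that] by (auto intro!: derivative_eq_intros)
      show "norm (V t - V 0 + (J (V t) - V t)) \<le> norm (V t - V 0) + C" for t
        using norm_triangle_ineq[of "J (V t) - J (V 0)" "J (V 0) - V 0"] J[of "V t" "V 0"]
        by (simp add: C_def)
    qed fact
    also have "\<dots> \<le> C * ((t\<^sup>2 + t) / (2 * A) + A / 2)"
    proof -
      have "t / (2 * A) \<ge> 0"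
        using 0 \<open>A > 0\<close> by simp
      then have "t \<le> (t\<^sup>2 + t) / (2 * A) + A / 2"
        using am_gm[of t] by (simp only: add_divide_distrib)
      from mult_left_mono[OF this \<open>C \<ge> 0\<close>] show ?thesis by simp
    qed
    finally show ?case by (simp add: C_def)
  next
    case (Suc n)
    define \<psi> where "\<psi> s = C * (((real (Suc n) - s)\<^sup>2 + s) / (2 * A) + A / 2)" for s
    define \<psi>' where "\<psi>' s = C * ((1 - 2 * (real (Suc n) - s)) / (2 * A))" for s
    have "exp t * (norm (V t - (J ^^ Suc n) (V 0)) - \<psi> t) \<le> norm (V 0 - (J ^^ Suc n) (V 0)) - \<psi> 0"
    proof (rule exp_weighted_comparison[where d = "\<lambda>t. V t - (J ^^ Suc n) (V 0)"])
      show "((\<lambda>t. V t - (J ^^ Suc n) (V 0)) has_vector_derivative J (V t) - V t) (at t within {0..})"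
        if "t \<ge> 0" for t
        using V[OF that] by (auto intro!: derivative_eq_intros)
      show "(\<psi> has_real_derivative \<psi>' s) (at s)" for s
        unfolding \<psi>_def \<psi>'_def using \<open>A > 0\<close>
        by (auto intro!: derivative_eq_intros simp: field_simps)
      fix s assume "0 < s" "s < t"
      have "norm (V s - (J ^^ Suc n) (V 0) + (J (V s) - V s)) \<le> norm (V s - (J ^^ n) (V 0))"
        using J[of "V s" "(J ^^ n) (V 0)"] by simp
      also have "\<dots> \<le> C * (((real n - s)\<^sup>2 + s) / (2 * A) + A / 2)"
        using Suc.IH[of s] \<open>0 < s\<close> by (simp add: C_def)
      also have "\<dots> = \<psi> s + \<psi>' s"
        unfolding \<psi>_def \<psi>'_def using \<open>A > 0\<close> by (simp add: field_simps power2_eq_square)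
      finally show "norm (V s - (J ^^ Suc n) (V 0) + (J (V s) - V s)) \<le> \<psi> s + \<psi>' s" .
    qed fact
    also have "\<dots> \<le> 0"
    proof -
      have "norm (V 0 - (J ^^ Suc n) (V 0)) \<le> real (Suc n) * C"
        using norm_funpow_diff_le[OF J, of "Suc n" "V 0"] by (simp add: norm_minus_commute C_def)
      also have "\<dots> \<le> \<psi> 0"
        using mult_left_mono[OF am_gm[of "real (Suc n)"] \<open>C \<ge> 0\<close>] by (simp add: \<psi>_def mult.commute)
      finally show ?thesis by simp
    qed
    finally show ?case
      by (simp add: mult_le_0_iff \<psi>_def C_def)
  }
qed

section \<open>The change of time\<close>

lemma exp_plus_id_inverse:
  obtains \<sigma> :: "real \<Rightarrow> real" where "\<And>t. exp (\<sigma> t) + \<sigma> t = t"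
    and "\<And>t. (\<sigma> has_real_derivative 1 / (1 + exp (\<sigma> t))) (at t)"
proof -
  define f where "f s = exp s + s" for s :: real
  have mono: "strict_mono f"
    by (auto simp: f_def strict_mono_def intro!: add_strict_mono)
  have cont: "isCont f s" for s
    unfolding f_def by (intro continuous_intros)
  have surj: "\<exists>s. f s = t" for t
  proof -
    have "\<exists>s\<ge>- \<bar>t\<bar> - 1. s \<le> \<bar>t\<bar> \<and> f s = t"
    proof (rule IVT)
      have "exp (- \<bar>t\<bar> - 1) \<le> (1::real)" by simp
      then show "f (- \<bar>t\<bar> - 1) \<le> t" unfolding f_def by linarith
      have "exp \<bar>t\<bar> \<ge> (0::real)" by simp
      then show "t \<le> f \<bar>t\<bar>" unfolding f_def by linarith
    qed (use cont in auto)
    then show ?thesis by blast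
  qed
  define \<sigma> where "\<sigma> = inv f"
  have inj: "inj f" using mono by (rule strict_mono_imp_inj_on)
  have f\<sigma>: "f (\<sigma> t) = t" for t
    unfolding \<sigma>_def using surj by (metis f_inv_into_f rangeI)
  have \<sigma>f: "\<sigma> (f s) = s" for s
    unfolding \<sigma>_def using inj by (rule inv_f_f)
  have cont\<sigma>: "isCont \<sigma> t" for t
    using isCont_inverse_function[of 1 "\<sigma> t" \<sigma> f] \<sigma>f cont by (simp add: f\<sigma>)
  show thesis
  proof
    show "exp (\<sigma> t) + \<sigma> t = t" for t
      using f\<sigma>[of t] by (simp add: f_def)
    show "(\<sigma> has_real_derivative 1 / (1 + exp (\<sigma> t))) (at t)" for t
    proof -
      have "(f has_real_derivative 1 + exp (\<sigma> t)) (at (\<sigma> t))"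
        unfolding f_def by (auto intro!: derivative_eq_intros)
      moreover have "1 + exp (\<sigma> t) \<noteq> 0"
        using exp_gt_zero[of "\<sigma> t"] by linarith
      ultimately show ?thesis
        using DERIV_inverse_function[where f = f and g = \<sigma> and x = t and D = "1 + exp (\<sigma> t)" and a = "t - 1" and b = "t + 1"] f\<sigma> cont\<sigma>
        by (simp add: inverse_eq_divide)
    qed
  qed
qed


section \<open>The nonautonomous equation\<close>

lemma Phi_nonexpansive:
  fixes J :: "'a::real_normed_vector \<Rightarrow> 'a"
  assumes J: "\<And>x y. norm (J x - J y) \<le> norm (x - y)" and "0 < l" "l \<le> 1"
  shows "norm (Phi J l x - Phi J l y) \<le> norm (x - y)"
proof -
  have "norm (Phi J l x - Phi J l y) \<le> l * norm (((1 - l) / l) *\<^sub>R x - ((1 - l) / l) *\<^sub>R y)"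
    using J \<open>0 < l\<close> by (simp add: Phi_def flip: scaleR_diff_right[of l])
  also have "\<dots> = (1 - l) * norm (x - y)"
    using \<open>0 < l\<close> \<open>l \<le> 1\<close> by (simp flip: scaleR_diff_right)
  also have "\<dots> \<le> norm (x - y)"
    using \<open>0 < l\<close> by (simp add: mult_left_le_one_le \<open>l \<le> 1\<close>)
  finally show ?thesis .
qed

lemma C1_solution_unique:
  fixes J :: "'a::real_normed_vector \<Rightarrow> 'a"
  assumes J: "\<And>x y. norm (J x - J y) \<le> norm (x - y)"
    and lam: "\<And>t. t \<ge> 0 \<Longrightarrow> 0 < lam t \<and> lam t \<le> 1"
    and w: "is_C1_solution J lam u0 w" and z: "is_C1_solution J lam u0 z" and "t \<ge> 0"
  shows "z t = w t"
proof -
  obtain w' where "w 0 = u0"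
    and w': "\<And>t. t \<ge> 0 \<Longrightarrow> (w has_vector_derivative w' t) (at t within {0..})"
      "\<And>t. t \<ge> 0 \<Longrightarrow> w t + w' t = Phi J (lam t) (w t)"
    using w unfolding is_C1_solution_def by blast
  obtain z' where "z 0 = u0"
    and z': "\<And>t. t \<ge> 0 \<Longrightarrow> (z has_vector_derivative z' t) (at t within {0..})"
      "\<And>t. t \<ge> 0 \<Longrightarrow> z t + z' t = Phi J (lam t) (z t)"
    using z unfolding is_C1_solution_def by blast
  have "norm (z t - w t) \<le> norm (z 0 - w 0) + 0 * t"
  proof (rule dissipative_growth_bound[where d = "\<lambda>t. z t - w t"])
    show "((\<lambda>t. z t - w t) has_vector_derivative z' t - w' t) (at t within {0..})" if "t \<ge> 0" for t
      using w'(1) z'(1) that by (auto intro!: derivative_eq_intros)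
    show "norm (z t - w t + (z' t - w' t)) \<le> norm (z t - w t) + 0" if "t \<ge> 0" for t
    proof -
      have "z t - w t + (z' t - w' t) = Phi J (lam t) (z t) - Phi J (lam t) (w t)"
        using w'(2)[OF that] z'(2)[OF that] by (simp add: algebra_simps)
      then show ?thesis
        using Phi_nonexpansive[of J "lam t" "z t" "w t"] J lam[OF that] by simp
    qed
  qed fact
  then show ?thesis
    using \<open>w 0 = u0\<close> \<open>z 0 = u0\<close> by simp
qed

lemma C1_solution_of_flow:
  fixes J :: "'a::real_normed_vector \<Rightarrow> 'a"
  assumes J: "\<And>x y. norm (J x - J y) \<le> norm (x - y)"
    and V: "\<And>t. t \<ge> 0 \<Longrightarrow> (V has_vector_derivative J (V t) - V t) (at t within {0..})"
    and \<tau>: "\<And>t. (\<tau> has_real_derivative 1 / (1 + exp (\<tau> t))) (at t)"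
    and \<tau>_nonneg: "\<And>t. t \<ge> 0 \<Longrightarrow> \<tau> t \<ge> 0" and "\<tau> 0 = 0"
  shows "is_C1_solution J (\<lambda>t. 1 / (1 + exp (\<tau> t))) (V 0)
    (\<lambda>t. exp (- \<tau> t) *\<^sub>R V (exp (\<tau> t) - 1))"
proof -
  define lam where "lam t = 1 / (1 + exp (\<tau> t))" for t
  define X where "X t = V (exp (\<tau> t) - 1)" for t
  define w where "w t = exp (- \<tau> t) *\<^sub>R X t" for t
  have pos: "1 + exp (\<tau> t) > 0" for t
    by (simp add: add_pos_pos)
  have X: "(X has_vector_derivative (exp (\<tau> t) * lam t) *\<^sub>R (J (X t) - X t)) (at t within {0..})"
    if "t \<ge> 0" for t
  proof -
    have "((\<lambda>t. exp (\<tau> t) - 1) has_real_derivative exp (\<tau> t) * lam t) (at t within {0..})"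
      using \<tau>[of t] unfolding lam_def
      by (auto intro!: derivative_eq_intros intro: has_field_derivative_at_within)
    moreover have "(V has_vector_derivative J (X t) - X t)
      (at (exp (\<tau> t) - 1) within (\<lambda>t. exp (\<tau> t) - 1) ` {0..})"
    proof (rule has_vector_derivative_within_subset)
      show "(V has_vector_derivative J (X t) - X t) (at (exp (\<tau> t) - 1) within {0..})"
        unfolding X_def using \<tau>_nonneg[OF that] by (intro V) simp
      show "(\<lambda>t. exp (\<tau> t) - 1) ` {0..} \<subseteq> {0..}"
        using \<tau>_nonneg by force
    qed
    ultimately show ?thesis
      unfolding has_real_derivative_iff_has_vector_derivative X_def
      using vector_diff_chain_within[where f = "\<lambda>t. exp (\<tau> t) - 1" and g = V] by (simp add: o_def)
  qed
  then have contX: "continuous_on {0..} X"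
    by (intro continuous_on_vector_derivative) auto
  have cont\<tau>: "continuous_on S \<tau>" for S
    by (rule DERIV_continuous_on[OF has_field_derivative_at_within[OF \<tau>]])
  have contJ: "continuous_on UNIV J"
    by (rule lipschitz_on_continuous_on[OF lipschitz_onI[of _ J 1]]) (use J in \<open>auto simp: dist_norm\<close>)
  have Phi: "Phi J (lam t) (w t) = lam t *\<^sub>R J (X t)" for t
  proof -
    have "(1 - lam t) / lam t = exp (\<tau> t)"
      using pos[of t] by (simp add: lam_def field_simps)
    then show ?thesis
      by (simp add: Phi_def w_def flip: exp_add)
  qed
  define w' where "w' t = lam t *\<^sub>R J (X t) - w t" for t
  have "continuous_on {0..} lam"
    unfolding lam_def using pos by (intro continuous_intros cont\<tau>) (simp add: less_imp_neq[symmetric])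
  then have "continuous_on {0..} w'"
    unfolding w'_def w_def
    by (intro continuous_intros contX cont\<tau> continuous_on_compose2[OF contJ contX]) auto
  moreover have "(w has_vector_derivative w' t) (at t within {0..})" if "t \<ge> 0" for t
  proof -
    have "((\<lambda>t. exp (- \<tau> t)) has_real_derivative - exp (- \<tau> t) * lam t) (at t within {0..})"
      using \<tau>[of t] unfolding lam_def
      by (auto intro!: derivative_eq_intros intro: has_field_derivative_at_within)
    from has_vector_derivative_scaleR[OF this X[OF that]]
    have "(w has_vector_derivative exp (- \<tau> t) *\<^sub>R (exp (\<tau> t) * lam t) *\<^sub>R (J (X t) - X t)
      + (- exp (- \<tau> t) * lam t) *\<^sub>R X t) (at t within {0..})"
      unfolding w_def .
    moreover have "exp (- \<tau> t) *\<^sub>R (exp (\<tau> t) * lam t) *\<^sub>R (J (X t) - X t)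
      + (- exp (- \<tau> t) * lam t) *\<^sub>R X t = w' t"
    proof -
      have "exp (- \<tau> t) = lam t + lam t * exp (- \<tau> t)"
      proof -
        have "exp (- \<tau> t) * (1 + exp (\<tau> t)) = 1 + exp (- \<tau> t)"
          by (simp add: distrib_left flip: exp_add)
        then show ?thesis
          using pos[of t] by (simp add: lam_def field_simps)
      qed
      then have "exp (- \<tau> t) *\<^sub>R X t = lam t *\<^sub>R X t + (lam t * exp (- \<tau> t)) *\<^sub>R X t"
        by (metis scaleR_add_left)
      then show ?thesis
        by (simp add: w'_def w_def exp_minus algebra_simps)
    qed
    ultimately show ?thesis by simp
  qed
  ultimately have "is_C1_solution J lam (V 0) w"
    unfolding is_C1_solution_def using \<open>\<tau> 0 = 0\<close>
    by (intro conjI exI[of _ w']) (auto simp: Phi w'_def, simp add: w_def X_def)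
  then show ?thesis
    by (simp add: lam_def[abs_def] w_def[abs_def] X_def)
qed

section \<open>Asymptotics\<close>

theorem proposition4p6:
  fixes J :: "'a::banach \<Rightarrow> 'a" and u0 :: 'a
  assumes nonexpansive: "\<And>x y. norm (J x - J y) \<le> norm (x - y)"
  shows "\<exists>lam :: real \<Rightarrow> real.
           continuous_on {0..} lam \<and>
           (\<forall>t\<ge>0. 0 < lam t \<and> lam t \<le> 1) \<and>
           ((\<lambda>t. t * lam t) \<longlongrightarrow> 1) at_top \<and>
           (\<exists>w :: real \<Rightarrow> 'a.
              is_the_C1_solution J lam u0 w \<and>
              (\<lambda>n. norm (w (real n) - v_seq J n)) \<longlonglongrightarrow> 0)"
proof -
  obtain V where V0: "V 0 = u0"
    and V: "\<And>t. t \<ge> 0 \<Longrightarrow> (V has_vector_derivative J (V t) - V t) (at t within {0..})"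
  proof (rule lipschitz_ode_solution_exists[of 2 "\<lambda>x. J x - x" u0])
    show "norm ((J x - x) - (J y - y)) \<le> 2 * norm (x - y)" for x y
      using norm_triangle_ineq4[of "J x - J y" "x - y"] nonexpansive[of x y]
      by (simp add: algebra_simps)
  qed auto
  obtain \<sigma> :: "real \<Rightarrow> real" where \<sigma>: "\<And>t. exp (\<sigma> t) + \<sigma> t = t"
    and \<sigma>': "\<And>t. (\<sigma> has_real_derivative 1 / (1 + exp (\<sigma> t))) (at t)"
    using exp_plus_id_inverse by blast
  define \<tau> where "\<tau> t = \<sigma> (t + 1)" for t
  have \<tau>: "exp (\<tau> t) = 1 + t - \<tau> t" for t
    using \<sigma>[of "t + 1"] by (simp add: \<tau>_def)
  have \<tau>': "(\<tau> has_real_derivative 1 / (1 + exp (\<tau> t))) (at t)" for t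
    using \<sigma>'[of "t + 1"] unfolding \<tau>_def by (simp add: DERIV_shift)
  have \<tau>_nonneg: "\<tau> t \<ge> 0" if "t \<ge> 0" for t
  proof (rule ccontr)
    assume "\<not> \<tau> t \<ge> 0"
    then have "exp (\<tau> t) < 1" by simp
    then show False using \<tau>[of t] that \<open>\<not> \<tau> t \<ge> 0\<close> by linarith
  qed
  have \<tau>_le: "\<tau> t \<le> ln (1 + t)" if "t \<ge> 0" for t
    using \<tau>[of t] \<tau>_nonneg[OF that] that by (subst ln_ge_iff) auto
  have \<tau>0: "\<tau> 0 = 0"
    using \<tau>_nonneg[of 0] \<tau>_le[of 0] by simp
  define lam where "lam t = 1 / (1 + exp (\<tau> t))" for t
  define w where "w t = exp (- \<tau> t) *\<^sub>R V (exp (\<tau> t) - 1)" for t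
  have pos: "1 + exp (\<tau> t) > 0" for t
    by (simp add: add_pos_pos)
  have lam: "0 < lam t \<and> lam t \<le> 1" for t
    using pos[of t] by (simp add: lam_def)
  have "continuous_on {0..} \<tau>"
    by (intro DERIV_continuous_on[OF has_field_derivative_at_within[OF \<tau>']])
  then have cont: "continuous_on {0..} lam"
    unfolding lam_def using pos by (intro continuous_intros) (simp_all add: less_imp_neq[symmetric])
  have "((\<lambda>t. t * lam t) \<longlongrightarrow> 1) at_top"
  proof (rule tendsto_sandwich)
    have lam_eq: "t * lam t = t / (2 + t - \<tau> t)" for t
      using \<tau>[of t] by (simp add: lam_def)
    show "\<forall>\<^sub>F t in at_top. t / (2 + t) \<le> t * lam t"
      using eventually_ge_at_top[of 0]
    proof eventually_elim
      case (elim t)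
      then show ?case
        unfolding lam_eq using \<tau>_nonneg[of t] pos[of t] \<tau>[of t] by (intro divide_left_mono) auto
    qed
    have "\<forall>\<^sub>F t::real in at_top. 0 < 2 + t - ln (1 + t)"
      by real_asymp
    then show "\<forall>\<^sub>F t in at_top. t * lam t \<le> t / (2 + t - ln (1 + t))"
      using eventually_ge_at_top[of 0]
    proof eventually_elim
      case (elim t)
      then show ?case
        unfolding lam_eq using \<tau>_le[of t] by (intro divide_left_mono) auto
    qed
    show "((\<lambda>t::real. t / (2 + t)) \<longlongrightarrow> 1) at_top"
      by real_asymp
    show "((\<lambda>t::real. t / (2 + t - ln (1 + t))) \<longlongrightarrow> 1) at_top"
      by real_asymp
  qed
  moreover have "is_the_C1_solution J lam u0 w"
  proof -
    have "is_C1_solution J lam u0 w"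
      using C1_solution_of_flow[OF nonexpansive V \<tau>' \<tau>_nonneg \<tau>0] V0
      by (simp add: lam_def[abs_def] w_def[abs_def])
    then show ?thesis
      unfolding is_the_C1_solution_def using C1_solution_unique[OF nonexpansive] lam by blast
  qed
  moreover have "(\<lambda>n. norm (w (real n) - v_seq J n)) \<longlonglongrightarrow> 0"
  proof (rule tendsto_sandwich[where f = "\<lambda>_. 0"])
    define C where "C = norm (J u0 - u0)"
    define N where "N = norm u0"
    define D where "D = norm (J 0)"
    define B where "B n = (C * ((ln (1 + n)^2 + n) / (2 * sqrt n) + sqrt n / 2) + N + D * (1 + ln (1 + n)))
      / (1 + n - ln (1 + n))" for n :: real
    have "\<forall>\<^sub>F n::nat in sequentially. 1 + real n - ln (1 + real n) > 0"
      by real_asymp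
    then show "\<forall>\<^sub>F n in sequentially. norm (w (real n) - v_seq J n) \<le> B (real n)"
      using eventually_gt_at_top[of 0]
    proof eventually_elim
      case (elim n)
      define l where "l = ln (1 + real n)"
      define m where "m = exp (\<tau> (real n))"
      have \<tau>n: "0 \<le> \<tau> (real n)" "\<tau> (real n) \<le> l"
        using \<tau>_nonneg[of "real n"] \<tau>_le[of "real n"] by (auto simp: l_def)
      have m: "m = 1 + real n - \<tau> (real n)" "m \<ge> 1" "m > 0"
        using \<tau>[of "real n"] \<tau>n(1) one_le_exp_iff[of "\<tau> (real n)"] exp_gt_zero[of "\<tau> (real n)"]
        unfolding m_def by blast+
      have "norm (V (m - 1) - (J ^^ n) u0)
          \<le> C * (((real n - (m - 1))\<^sup>2 + (m - 1)) / (2 * sqrt n) + sqrt n / 2)"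
        using chernoff_estimate[OF nonexpansive V, of "sqrt n" "m - 1" n] m elim
        by (simp add: V0 C_def)
      also have "\<dots> \<le> C * ((l\<^sup>2 + n) / (2 * sqrt n) + sqrt n / 2)"
        using \<tau>n m(1)
        by (intro mult_left_mono add_mono divide_right_mono power_mono) (auto simp: C_def)
      finally have 1: "norm (V (m - 1) - (J ^^ n) u0) \<le> C * ((l\<^sup>2 + n) / (2 * sqrt n) + sqrt n / 2)" .
      have 2: "norm ((J ^^ n) u0 - (J ^^ n) 0) \<le> N"
        using funpow_nonexpansive[OF nonexpansive, of n u0 0] by (simp add: N_def)
      have 3: "norm (((real n - m) / real n) *\<^sub>R (J ^^ n) 0) \<le> D * (1 + l)"
      proof -
        have "norm (((real n - m) / real n) *\<^sub>R (J ^^ n) 0) = \<bar>real n - m\<bar> / real n * norm ((J ^^ n) 0)"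
          by simp
        also have "\<dots> \<le> \<bar>real n - m\<bar> / real n * (real n * D)"
          using norm_funpow_diff_le[OF nonexpansive, of n 0]
          by (intro mult_left_mono) (auto simp: D_def)
        also have "\<dots> = D * \<bar>real n - m\<bar>"
          using elim by simp
        also have "\<dots> \<le> D * (1 + l)"
          using m(1) \<tau>n by (intro mult_left_mono) (auto simp: D_def)
        finally show ?thesis .
      qed
      \<comment> \<open>Since \<open>w n = V (m - 1) / m\<close>, the difference splits into the gap between flow and
        iterates, the change of starting point, and the change of normalization.\<close>
      have "w (real n) - v_seq J n = (1 / m) *\<^sub>R ((V (m - 1) - (J ^^ n) u0)
        + ((J ^^ n) u0 - (J ^^ n) 0) + ((real n - m) / real n) *\<^sub>R (J ^^ n) 0)"
      proof -
        have "(1 / m) * ((real n - m) / real n) = 1 / m - 1 / real n"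
          using m elim by (simp add: field_simps)
        then show ?thesis
          by (simp add: w_def v_seq_def m_def exp_minus inverse_eq_divide scaleR_add_right
              scaleR_diff_right scaleR_diff_left)
      qed
      then have "norm (w (real n) - v_seq J n) = norm ((V (m - 1) - (J ^^ n) u0)
        + ((J ^^ n) u0 - (J ^^ n) 0) + ((real n - m) / real n) *\<^sub>R (J ^^ n) 0) / m"
        using m by simp
      also have "\<dots> \<le> (C * ((l\<^sup>2 + n) / (2 * sqrt n) + sqrt n / 2) + N + D * (1 + l)) / m"
        using m by (intro divide_right_mono norm_triangle_le add_mono 1 2 3) auto
      also have "\<dots> \<le> B (real n)"
        unfolding B_def l_def[symmetric] using elim m \<tau>n
        by (intro divide_left_mono mult_pos_pos add_nonneg_nonneg mult_nonneg_nonneg)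
          (auto simp: C_def N_def D_def l_def)
      finally show ?case .
    qed
    have "(B \<longlongrightarrow> 0) at_top"
      unfolding B_def by real_asymp
    then show "(\<lambda>n. B (real n)) \<longlonglongrightarrow> 0"
      by (rule filterlim_compose) (rule filterlim_real_sequentially)
  qed auto
  ultimately show ?thesis
    using cont lam by blast
qed

end
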